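(* Consider the setting of the context, let $\varepsilon':=K\varepsilon$, and let $\boldsymbol\lambda^{R*}$ be a maximizer of $D(\boldsymbol\lambda^R)$ over $\boldsymbol\lambda^R\ge\mathbf 0$. If $\beta>0$ is a (sufficiently) small constant stepsize, there exists an initial point ${\boldsymbol\lambda^R}^{(0)}$ such that: (i) the iteration $${\boldsymbol\lambda^R}^{(i)}={\boldsymbol\lambda^R}^{(i-1)}+\beta\,\partial^sD\big({\boldsymbol\lambda^R}^{(i-1)}\big),\qquad i=1,2,\dots,$$ converges, i.e., ${\boldsymbol\lambda^R}^{(i)}\to\boldsymbol\lambda^{Rs}$ for some limit point $\boldsymbol\lambda^{Rs}$; and (ii) at the limit point it holds that $$D(\boldsymbol\lambda^{R*})\le D^s(\boldsymbol\lambda^{Rs})<D(\boldsymbol\lambda^{R*})+\varepsilon'.$$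
   Context: There are $M$ users and $K$ orthogonal channels. The quantized channel state is a random $M\times K$ matrix $\mathbf J$ taking values in a finite set $\mathcal J$ with probability mass function $\Pr\{\mathbf J\}>0$; the entry $[\mathbf J]_{m,k}$ is the index of a quantization region $\mathcal R([\mathbf J]_{m,k})$, to which a power-rate function $\Upsilon_{\mathcal R([\mathbf J]_{m,k})}$ of the rate $x\ge0$ is associated. Standing assumption: each $\Upsilon_{\mathcal R([\mathbf J]_{m,k})}$ is increasing and strictly convex; it is differentiable (as often as needed), $\dot\Upsilon$ denotes its derivative and $\dot\Upsilon^{-1}$ the inverse function of $\dot\Upsilon$. $[\boldsymbol\mu]_m>0$ are user weights, $\check{\mathbf r}\in\mathbb R^M$ collects the minimum average rate requirements. Primal problem: minimize $\sum_{\mathbf J}\sum_{m}[\boldsymbol\mu]_m\sum_{k}\Upsilon_{\mathcal R([\mathbf J]_{m,k})}\big([\tilde{\mathbf R}(\mathbf J)]_{m,k}/[\mathbf W(\mathbf J)]_{m,k}\big)[\mathbf W(\mathbf J)]_{m,k}\Pr\{\mathbf J\}$ over $\tilde{\mathbf R}(\mathbf J)\ge0$, $\mathbf W(\mathbf J)\ge0$ ($M\times K$ matrices for each $\mathbf J\in\mathcal J$) subject to $\sum_{\mathbf J}\sum_k[\tilde{\mathbf R}(\mathbf J)]_{m,k}\Pr\{\mathbf J\}\ge[\check{\mathbf r}]_m$ for all $m$ and $\sum_m[\mathbf W(\mathbf J)]_{m,k}\le1$ for all $k,\mathbf J$. Here $[\tilde{\mathbf R}]_{m,k}=[\mathbf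 R]_{m,k}[\mathbf W]_{m,k}$ with $[\mathbf R]_{m,k}$ the nominal rate, so $[\mathbf W]_{m,k}=0$ forces $[\tilde{\mathbf R}]_{m,k}=0$ and the cost term is then $0$. The problem is convex and assumed strictly feasible. Lagrangian: $$\mathcal L(\boldsymbol\lambda^R,\tilde{\mathbf R},\mathbf W):=\sum_{\mathbf J}\sum_m\sum_k[\boldsymbol\mu]_m\Upsilon_{\mathcal R([\mathbf J]_{m,k})}\left(\tfrac{[\tilde{\mathbf R}(\mathbf J)]_{m,k}}{[\mathbf W(\mathbf J)]_{m,k}}\right)[\mathbf W(\mathbf J)]_{m,k}\Pr\{\mathbf J\}-\sum_m[\boldsymbol\lambda^R]_m\sum_{\mathbf J}\sum_k[\tilde{\mathbf R}(\mathbf J)]_{m,k}\Pr\{\mathbf J\}+\sum_m[\boldsymbol\lambda^R]_m[\check{\mathbf r}]_m .$$ Dual function: $D(\boldsymbol\lambda^R):=\inf\mathcal L(\boldsymbol\lambda^R,\tilde{\mathbf R},\mathbf W)$, the infimum being over all $\tilde{\mathbf R}(\mathbf J)\ge0$, $\mathbf W(\mathbf J)\ge0$ with $\sum_m[\mathbf W(\mathbf J)]_{m,k}\le1$ for all $k,\mathbf J$. Nominal rates: $[\mathbf R^*(\mathbf J,\boldsymbol\lambda^R)]_{m,k}:=\dot\Upsilon^{-1}_{\mathcal R([\mathbf J]_{m,k})}([\boldsymbol\lambda^R]_m/[\boldsymbol\mu]_m)$, set to $0$ when $[\boldsymbol\lambda^R]_m/[\boldsymbol\mu]_m<\dot\Upsilon_{\mathcal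 R([\mathbf J]_{m,k})}(0)$; nominal rates are assumed to be bounded above by the finite maximum nominal rate that the system hardware can implement. Costs: $[\mathbf C_W(\mathbf J,\boldsymbol\lambda^R)]_{m,k}:=[\boldsymbol\mu]_m\Upsilon_{\mathcal R([\mathbf J]_{m,k})}([\mathbf R^*(\mathbf J,\boldsymbol\lambda^R)]_{m,k})-[\boldsymbol\lambda^R]_m[\mathbf R^*(\mathbf J,\boldsymbol\lambda^R)]_{m,k}$ and $[\mathbf c_W^*(\mathbf J,\boldsymbol\lambda^R)]_k:=\min_m[\mathbf C_W(\mathbf J,\boldsymbol\lambda^R)]_{m,k}$. Smooth scheduling: for a fixed small $\varepsilon>0$, let $\mathcal M^s(\mathbf J,k):=\{m:\ [\mathbf C_W(\mathbf J,\boldsymbol\lambda^R)]_{m,k}-[\mathbf c_W^*(\mathbf J,\boldsymbol\lambda^R)]_k<\varepsilon\ \text{and}\ [\mathbf c_W^*(\mathbf J,\boldsymbol\lambda^R)]_k<0\}$ and, with $n_{m,k}:=1-\big([\mathbf C_W(\mathbf J,\boldsymbol\lambda^R)]_{m,k}-[\mathbf c_W^*(\mathbf J,\boldsymbol\lambda^R)]_k\big)/\varepsilon$, $$[\mathbf W^s(\mathbf J,\boldsymbol\lambda^R)]_{m,k}:=\frac{n_{m,k}^2}{\sum_{m'\in\mathcal M^s(\mathbf J,k)}n_{m',k}^2}\ \text{ if } m\in\mathcal M^s(\mathbf J,k),\qquad [\mathbf W^s(\mathbf J,\boldsymbol\lambda^R)]_{m,k}:=0\ \text{ otherwise.}$$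 Smooth dual function: $D^s(\boldsymbol\lambda^R):=\mathcal L\big(\boldsymbol\lambda^R,\ \mathbf R^*(\mathbf J,\boldsymbol\lambda^R)\odot\mathbf W^s(\mathbf J,\boldsymbol\lambda^R),\ \mathbf W^s(\mathbf J,\boldsymbol\lambda^R)\big)$, with $\odot$ the entrywise product. Smooth subgradient: the vector $\partial^sD(\boldsymbol\lambda^R)\in\mathbb R^M$ with entries $$[\partial^sD(\boldsymbol\lambda^R)]_m:=[\check{\mathbf r}]_m-\sum_{\mathbf J}\sum_k[\mathbf R^*(\mathbf J,\boldsymbol\lambda^R)]_{m,k}[\mathbf W^s(\mathbf J,\boldsymbol\lambda^R)]_{m,k}\Pr\{\mathbf J\}.$$
   Formalization: The minimum rates are assumed nonnegative and each power-rate function vanishes at rate 0 (the claim fails otherwise); the maximum nominal rate, if finite, bounds the rates both in R* and in the infimum defining D; if there is none, the derivative takes every value above its value at 0. *)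

theory Defs
  imports "HOL-Probability.Probability"
begin

text \<open>
  Users and channels are the elements of the finite types \<open>'m\<close> and \<open>'k\<close>. The random channel state has
  distribution \<open>p\<close>; the finite set of its values is \<open>set_pmf p\<close>, so every one of them has positive
  probability. \<open>J $ m $ k\<close> is a region index of type \<open>'q\<close>, and \<open>Y q\<close>, \<open>dY q\<close> are the power-rate
  function of region \<open>q\<close> and its derivative.
\<close>

definition strictly_convex_on :: "real set \<Rightarrow> (real \<Rightarrow> real) \<Rightarrow> bool" where
  "strictly_convex_on S f \<longleftrightarrow> convex S \<and>
     (\<forall>x\<in>S. \<forall>y\<in>S. \<forall>t. x \<noteq> y \<longrightarrow> 0 < t \<longrightarrow> t < 1 \<longrightarrow>
        f ((1 - t) * x + t * y) < (1 - t) * f x + t * f y)"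

text \<open>
  \<open>rmax\<close> bounds all nominal rates \<open>R / W\<close>; \<open>rmax = \<infinity>\<close> means that no bound is imposed.
  As \<open>x / 0 = 0\<close>, the bound is void where \<open>W\<close> vanishes, and there \<open>R\<close> has to vanish as well.
\<close>

definition allocations ::
  "('q ^ 'k ^ 'm) pmf \<Rightarrow> ereal \<Rightarrow>
   (('q ^ 'k ^ 'm \<Rightarrow> real ^ 'k ^ 'm) \<times> ('q ^ 'k ^ 'm \<Rightarrow> real ^ 'k ^ 'm)) set" where
  "allocations p rmax = {(R, W). \<forall>J\<in>set_pmf p.
     (\<forall>m k. 0 \<le> R J $ m $ k \<and> 0 \<le> W J $ m $ k \<and>
            (W J $ m $ k = 0 \<longrightarrow> R J $ m $ k = 0) \<and>
            ereal (R J $ m $ k / W J $ m $ k) \<le> rmax) \<and>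
     (\<forall>k. (\<Sum>m\<in>UNIV. W J $ m $ k) \<le> 1)}"

text \<open>Slater's condition for the rate constraints, the only ones that are dualized.\<close>

definition strictly_feasible :: "('q ^ 'k ^ 'm) pmf \<Rightarrow> ereal \<Rightarrow> real ^ 'm \<Rightarrow> bool" where
  "strictly_feasible p rmax rmin \<longleftrightarrow> (\<exists>(R, W)\<in>allocations p rmax.
     \<forall>m. (\<Sum>J\<in>set_pmf p. \<Sum>k\<in>UNIV. R J $ m $ k * pmf p J) > rmin $ m)"

text \<open>Where \<open>W\<close> vanishes, the power term is \<open>0\<close> as required, since \<open>x / 0 = 0\<close>.\<close>

definition lagrangian ::
  "('q ^ 'k ^ 'm) pmf \<Rightarrow> real ^ 'm \<Rightarrow> ('q \<Rightarrow> real \<Rightarrow> real) \<Rightarrow> real ^ 'm \<Rightarrow> real ^ 'm \<Rightarrow>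
   ('q ^ 'k ^ 'm \<Rightarrow> real ^ 'k ^ 'm) \<Rightarrow> ('q ^ 'k ^ 'm \<Rightarrow> real ^ 'k ^ 'm) \<Rightarrow> real" where
  "lagrangian p \<mu> Y rmin lam R W =
     (\<Sum>J\<in>set_pmf p. \<Sum>m\<in>UNIV. \<Sum>k\<in>UNIV.
        \<mu> $ m * Y (J $ m $ k) (R J $ m $ k / W J $ m $ k) * W J $ m $ k * pmf p J)
     - (\<Sum>m\<in>UNIV. lam $ m * (\<Sum>J\<in>set_pmf p. \<Sum>k\<in>UNIV. R J $ m $ k * pmf p J))
     + (\<Sum>m\<in>UNIV. lam $ m * rmin $ m)"

text \<open>
  Under the hypotheses of the theorem the Lagrangian is bounded below on the nonempty set
  \<open>allocations p rmax\<close>, so the real-valued infimum is the actual one.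
\<close>

definition dual_function ::
  "('q ^ 'k ^ 'm) pmf \<Rightarrow> real ^ 'm \<Rightarrow> ('q \<Rightarrow> real \<Rightarrow> real) \<Rightarrow> ereal \<Rightarrow> real ^ 'm \<Rightarrow>
   real ^ 'm \<Rightarrow> real" where
  "dual_function p \<mu> Y rmax rmin lam =
     (INF (R, W)\<in>allocations p rmax. lagrangian p \<mu> Y rmin lam R W)"

text \<open>The inverse of \<open>dY q\<close>, set to \<open>0\<close> below \<open>dY q 0\<close> and to \<open>rmax\<close> above \<open>dY q rmax\<close>.\<close>

definition inverse_rate :: "(real \<Rightarrow> real) \<Rightarrow> ereal \<Rightarrow> real \<Rightarrow> real" where
  "inverse_rate f' rmax y =
     (if y < f' 0 then 0
      else if rmax < \<infinity> \<and> f' (real_of_ereal rmax) < y then real_of_ereal rmax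
      else inv_into {0..} f' y)"

definition nominal_rate ::
  "real ^ 'm \<Rightarrow> ('q \<Rightarrow> real \<Rightarrow> real) \<Rightarrow> ereal \<Rightarrow> 'q ^ 'k ^ 'm \<Rightarrow> real ^ 'm \<Rightarrow> real ^ 'k ^ 'm" where
  "nominal_rate \<mu> dY rmax J lam = (\<chi> m k. inverse_rate (dY (J $ m $ k)) rmax (lam $ m / \<mu> $ m))"

definition cost_W ::
  "real ^ 'm \<Rightarrow> ('q \<Rightarrow> real \<Rightarrow> real) \<Rightarrow> ('q \<Rightarrow> real \<Rightarrow> real) \<Rightarrow> ereal \<Rightarrow>
   'q ^ 'k ^ 'm \<Rightarrow> real ^ 'm \<Rightarrow> real ^ 'k ^ 'm" where
  "cost_W \<mu> Y dY rmax J lam = (\<chi> m k.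
     \<mu> $ m * Y (J $ m $ k) (nominal_rate \<mu> dY rmax J lam $ m $ k)
     - lam $ m * nominal_rate \<mu> dY rmax J lam $ m $ k)"

definition min_cost ::
  "real ^ 'm \<Rightarrow> ('q \<Rightarrow> real \<Rightarrow> real) \<Rightarrow> ('q \<Rightarrow> real \<Rightarrow> real) \<Rightarrow> ereal \<Rightarrow>
   'q ^ 'k ^ 'm \<Rightarrow> real ^ 'm \<Rightarrow> real ^ 'k" where
  "min_cost \<mu> Y dY rmax J lam = (\<chi> k. MIN m. cost_W \<mu> Y dY rmax J lam $ m $ k)"

definition smooth_users ::
  "real ^ 'm \<Rightarrow> ('q \<Rightarrow> real \<Rightarrow> real) \<Rightarrow> ('q \<Rightarrow> real \<Rightarrow> real) \<Rightarrow> ereal \<Rightarrow> real \<Rightarrow>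
   'q ^ 'k ^ 'm \<Rightarrow> real ^ 'm \<Rightarrow> 'k \<Rightarrow> 'm set" where
  "smooth_users \<mu> Y dY rmax \<epsilon> J lam k = {m.
     cost_W \<mu> Y dY rmax J lam $ m $ k - min_cost \<mu> Y dY rmax J lam $ k < \<epsilon> \<and>
     min_cost \<mu> Y dY rmax J lam $ k < 0}"

definition smooth_weight ::
  "real ^ 'm \<Rightarrow> ('q \<Rightarrow> real \<Rightarrow> real) \<Rightarrow> ('q \<Rightarrow> real \<Rightarrow> real) \<Rightarrow> ereal \<Rightarrow> real \<Rightarrow>
   'q ^ 'k ^ 'm \<Rightarrow> real ^ 'm \<Rightarrow> 'm \<Rightarrow> 'k \<Rightarrow> real" where
  "smooth_weight \<mu> Y dY rmax \<epsilon> J lam m k =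
     1 - (cost_W \<mu> Y dY rmax J lam $ m $ k - min_cost \<mu> Y dY rmax J lam $ k) / \<epsilon>"

definition smooth_schedule ::
  "real ^ 'm \<Rightarrow> ('q \<Rightarrow> real \<Rightarrow> real) \<Rightarrow> ('q \<Rightarrow> real \<Rightarrow> real) \<Rightarrow> ereal \<Rightarrow> real \<Rightarrow>
   'q ^ 'k ^ 'm \<Rightarrow> real ^ 'm \<Rightarrow> real ^ 'k ^ 'm" where
  "smooth_schedule \<mu> Y dY rmax \<epsilon> J lam = (\<chi> m k.
     if m \<in> smooth_users \<mu> Y dY rmax \<epsilon> J lam k
     then (smooth_weight \<mu> Y dY rmax \<epsilon> J lam m k)\<^sup>2 /
          (\<Sum>m'\<in>smooth_users \<mu> Y dY rmax \<epsilon> J lam k. (smooth_weight \<mu> Y dY rmax \<epsilon> J lam m' k)\<^sup>2)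
     else 0)"

definition smooth_dual ::
  "('q ^ 'k ^ 'm) pmf \<Rightarrow> real ^ 'm \<Rightarrow> ('q \<Rightarrow> real \<Rightarrow> real) \<Rightarrow> ('q \<Rightarrow> real \<Rightarrow> real) \<Rightarrow> ereal \<Rightarrow>
   real ^ 'm \<Rightarrow> real \<Rightarrow> real ^ 'm \<Rightarrow> real" where
  "smooth_dual p \<mu> Y dY rmax rmin \<epsilon> lam =
     lagrangian p \<mu> Y rmin lam
       (\<lambda>J. \<chi> m k. nominal_rate \<mu> dY rmax J lam $ m $ k *
                    smooth_schedule \<mu> Y dY rmax \<epsilon> J lam $ m $ k)
       (\<lambda>J. smooth_schedule \<mu> Y dY rmax \<epsilon> J lam)"

definition smooth_subgradient ::
  "('q ^ 'k ^ 'm) pmf \<Rightarrow> real ^ 'm \<Rightarrow> ('q \<Rightarrow> real \<Rightarrow> real) \<Rightarrow> ('q \<Rightarrow> real \<Rightarrow> real) \<Rightarrow> ereal \<Rightarrow>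
   real ^ 'm \<Rightarrow> real \<Rightarrow> real ^ 'm \<Rightarrow> real ^ 'm" where
  "smooth_subgradient p \<mu> Y dY rmax rmin \<epsilon> lam = (\<chi> m.
     rmin $ m - (\<Sum>J\<in>set_pmf p. \<Sum>k\<in>UNIV.
       nominal_rate \<mu> dY rmax J lam $ m $ k *
       smooth_schedule \<mu> Y dY rmax \<epsilon> J lam $ m $ k * pmf p J))"

primrec smooth_iterate ::
  "('q ^ 'k ^ 'm) pmf \<Rightarrow> real ^ 'm \<Rightarrow> ('q \<Rightarrow> real \<Rightarrow> real) \<Rightarrow> ('q \<Rightarrow> real \<Rightarrow> real) \<Rightarrow> ereal \<Rightarrow>
   real ^ 'm \<Rightarrow> real \<Rightarrow> real \<Rightarrow> real ^ 'm \<Rightarrow> nat \<Rightarrow> real ^ 'm" where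
  "smooth_iterate p \<mu> Y dY rmax rmin \<epsilon> \<beta> lam0 0 = lam0"
| "smooth_iterate p \<mu> Y dY rmax rmin \<epsilon> \<beta> lam0 (Suc i) =
     smooth_iterate p \<mu> Y dY rmax rmin \<epsilon> \<beta> lam0 i +
     \<beta> *\<^sub>R smooth_subgradient p \<mu> Y dY rmax rmin \<epsilon>
            (smooth_iterate p \<mu> Y dY rmax rmin \<epsilon> \<beta> lam0 i)"

end

theory Submission
  imports Defs
begin

text \<open>
  Every zero \<open>lam \<ge> 0\<close> of the smooth subgradient is an initial point at which the iteration is
  constant. There the smooth dual value is the power of a feasible allocation, so it is at least
  the dual optimum by weak duality; and it is below \<open>D lam + K \<epsilon>\<close> because on each channel only
  users within \<open>\<epsilon>\<close> of the least cost are served. A zero exists by Brouwer's theorem: the smooth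
  subgradient is continuous, is nonnegative in each coordinate where \<open>lam\<close> vanishes, and by
  Slater's condition has negative inner product with \<open>lam\<close> far out in the orthant.
\<close>

section \<open>Analytic preliminaries: variational inequalities, finite minima, Darboux's
  theorem\<close>

text \<open>Brouwer yields a fixed point \<open>x\<close> of the projected step
  \<open>x \<mapsto> closest_point C (x + g x)\<close>. The obtuse-angle property of projections,
  with \<open>x\<close> the projection of \<open>x + g x\<close>, is then the inequality.\<close>

lemma variational_inequality:
  fixes g :: "'a::euclidean_space \<Rightarrow> 'a"
  assumes "compact C" "convex C" "C \<noteq> {}" "continuous_on C g"
  obtains x where "x \<in> C" "\<And>y. y \<in> C \<Longrightarrow> g x \<bullet> (y - x) \<le> 0"
proof -
  have C: "closed C" using assms(1) compact_imp_closed by blast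
  have "continuous_on C (\<lambda>x. closest_point C (x + g x))"
    by (rule continuous_on_compose2[OF continuous_on_closest_point[OF assms(2) C assms(3), of UNIV]])
      (auto intro!: continuous_intros assms)
  moreover have "(\<lambda>x. closest_point C (x + g x)) \<in> C \<rightarrow> C"
    using closest_point_in_set[OF C assms(3)] by auto
  ultimately obtain x where x: "x \<in> C" "closest_point C (x + g x) = x"
    by (rule brouwer[OF assms(1-3)])
  have "g x \<bullet> (y - x) \<le> 0" if "y \<in> C" for y
    using closest_point_dot[OF assms(2) C that, of "x + g x"] x(2) by simp
  with x(1) show thesis using that by blast
qed

lemma continuous_on_Min_image:
  fixes f :: "'i \<Rightarrow> 'a::topological_space \<Rightarrow> real"
  assumes "finite A" "A \<noteq> {}" "\<And>i. i \<in> A \<Longrightarrow> continuous_on S (f i)"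
  shows "continuous_on S (\<lambda>x. Min ((\<lambda>i. f i x) ` A))"
  using assms
proof (induction A rule: finite_ne_induct)
  case (insert i A)
  then have "continuous_on S (\<lambda>x. min (f i x) (Min ((\<lambda>i. f i x) ` A)))"
    by (intro continuous_on_min) auto
  with insert show ?case by simp
qed simp

text \<open>Darboux's argument: a minimizer of \<open>f x - y * x\<close> on the compact interval
  has slope 0. This inverts \<open>f'\<close> between two of its values without any continuity of
  \<open>f'\<close>.\<close>

lemma derivative_intermediate_value:
  fixes f f' :: "real \<Rightarrow> real"
  assumes "a \<le> b" "f' a \<le> y" "y \<le> f' b"
    and der: "\<And>x. a \<le> x \<Longrightarrow> x \<le> b \<Longrightarrow> (f has_real_derivative f' x) (at x within {a..b})"
  obtains x where "a \<le> x" "x \<le> b" "f' x = y"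
proof -
  define h where "h x = f x - y * x" for x
  have h: "(h has_real_derivative f' x - y) (at x within {a..b})" if "a \<le> x" "x \<le> b" for x
    unfolding h_def using der[OF that] by (auto intro!: derivative_eq_intros)
  then have "continuous_on {a..b} h"
    by (intro DERIV_continuous_on) auto
  then obtain x where x: "x \<in> {a..b}" "\<And>z. z \<in> {a..b} \<Longrightarrow> h x \<le> h z"
    using continuous_attains_inf[of "{a..b}" h] assms(1) by auto
  have D: "(h has_real_derivative f' x - y) (at x within {a..b})" using h x(1) by auto
  \<comment> \<open>At a minimizer the slope can be negative only at the right end and positive only
    at the left end; there the bounds on \<open>f' b\<close> and \<open>f' a\<close> exclude
    it.\<close>
  have 1: "x = b" if neg: "f' x - y < 0"
  proof (rule ccontr)
    assume "x \<noteq> b"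
    obtain d where d: "d > 0" "\<And>t. t > 0 \<Longrightarrow> x + t \<in> {a..b} \<Longrightarrow> t < d \<Longrightarrow> h (x + t) < h x"
      using has_real_derivative_neg_dec_right[OF D neg] by blast
    define t where "t = min (d / 2) (b - x)"
    have "t > 0" "t < d" "x + t \<in> {a..b}"
      using x(1) \<open>x \<noteq> b\<close> d(1) by (auto simp: t_def)
    then show False using d(2)[of t] x(2)[of "x + t"] by auto
  qed
  have 2: "x = a" if pos: "f' x - y > 0"
  proof (rule ccontr)
    assume "x \<noteq> a"
    obtain d where d: "d > 0" "\<And>t. t > 0 \<Longrightarrow> x - t \<in> {a..b} \<Longrightarrow> t < d \<Longrightarrow> h (x - t) < h x"
      using has_real_derivative_pos_inc_left[OF D pos] by blast
    define t where "t = min (d / 2) (x - a)"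
    have "t > 0" "t < d" "x - t \<in> {a..b}"
      using x(1) \<open>x \<noteq> a\<close> d(1) by (auto simp: t_def)
    then show False using d(2)[of t] x(2)[of "x - t"] by auto
  qed
  have "f' x = y"
    using 1 2 assms(2,3) by (cases "f' x" y rule: linorder_cases) auto
  with x(1) show thesis using that by auto
qed

section \<open>One power-rate function: its nominal rate as a minimizer, and continuity of that
  rate\<close>

text \<open>At 0 the derivative is one-sided. For finite \<open>rmax\<close>, Darboux provides the
  preimages under \<open>f'\<close>; for \<open>rmax = \<infinity>\<close> the derivative could stay
  bounded, so \<open>unbounded\<close> demands that every level from \<open>f' 0\<close> on be
  attained.\<close>

locale power_rate =
  fixes f f' :: "real \<Rightarrow> real" and rmax :: ereal
  assumes increasing: "mono_on {0..} f"
    and str_convex: "strictly_convex_on {0..} f"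
    and derivative: "\<And>x. 0 \<le> x \<Longrightarrow> (f has_real_derivative f' x) (at x within {0..})"
    and zero: "f 0 = 0"
    and max_rate: "0 < rmax"
    and unbounded: "rmax = \<infinity> \<Longrightarrow> {f' 0..} \<subseteq> f' ` {0..}"
begin

lemma strict: "x \<noteq> y \<Longrightarrow> 0 \<le> x \<Longrightarrow> 0 \<le> y \<Longrightarrow> 0 < t \<Longrightarrow> t < 1 \<Longrightarrow>
    f ((1 - t) * x + t * y) < (1 - t) * f x + t * f y"
  using str_convex by (auto simp: strictly_convex_on_def)

lemma nonneg: "0 \<le> x \<Longrightarrow> 0 \<le> f x"
  using increasing zero by (metis atLeast_iff mono_onD order_refl)

text \<open>Along the segment from \<open>r\<close> to \<open>x\<close>, convexity bounds the
  difference quotients by \<open>f x - f r\<close>; their limit at the start is the slope times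
  \<open>x - r\<close>.\<close>

lemma above_tangent:
  assumes "0 \<le> r" "0 \<le> x"
  shows "f r + f' r * (x - r) \<le> f x"
proof (cases "x = r")
  case False
  define g where "g t = f (r + t * (x - r))" for t
  have in0: "0 \<le> r + t * (x - r)" if "0 \<le> t" "t \<le> 1" for t
  proof -
    have "0 \<le> (1 - t) * r + t * x" using that assms by simp
    then show ?thesis by (simp add: algebra_simps)
  qed
  \<comment> \<open>Differentiating within the segment only also covers \<open>r = 0\<close>, where
    the derivative is one-sided.\<close>
  have "(f has_real_derivative f' r) (at (r + 0 * (x - r)) within (\<lambda>t. r + t * (x - r)) ` {0..1})"
    using DERIV_subset[OF derivative[OF assms(1)]] in0 by (simp add: image_subset_iff)
  moreover have "((\<lambda>t. r + t * (x - r)) has_real_derivative (x - r)) (at 0 within {0..1})"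
    by (auto intro!: derivative_eq_intros)
  ultimately have "(g has_real_derivative f' r * (x - r)) (at 0 within {0..1})"
    unfolding g_def using DERIV_image_chain[of f "f' r" "\<lambda>t. r + t * (x - r)" 0 "{0..1}"]
    by (simp add: o_def)
  then have "((\<lambda>t. (g t - g 0) / (t - 0)) \<longlongrightarrow> f' r * (x - r)) (at 0 within {0..1})"
    by (simp add: has_field_derivative_iff)
  moreover have "\<forall>\<^sub>F t in at 0 within {0..1}. (g t - g 0) / (t - 0) \<le> f x - f r"
    unfolding eventually_at
  proof (intro exI[of _ 1] conjI ballI impI)
    fix t :: real assume "t \<in> {0..1}" "t \<noteq> 0 \<and> dist t 0 < 1"
    then have t: "0 < t" "t < 1" by auto
    have "g t < (1 - t) * f r + t * f x"
      using strict[of r x t] False assms t by (simp add: g_def algebra_simps)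
    then show "(g t - g 0) / (t - 0) \<le> f x - f r"
      using t by (simp add: g_def field_simps)
  qed simp
  ultimately have "f' r * (x - r) \<le> f x - f r"
    by (rule tendsto_upperbound) (simp add: at_within_Icc_at_right)
  then show ?thesis by simp
qed simp

text \<open>The weak tangent bound is applied at the midpoint of \<open>r\<close> and
  \<open>x\<close>, where strict convexity adds the strictness.\<close>

lemma strictly_above_tangent:
  assumes "0 \<le> r" "0 \<le> x" "x \<noteq> r"
  shows "f r + f' r * (x - r) < f x"
proof -
  have "f r + f' r * ((r + x) / 2 - r) \<le> f ((r + x) / 2)"
    by (rule above_tangent) (use assms in auto)
  also have "\<dots> < (f r + f x) / 2"
    using strict[of r x "1/2"] assms by (simp add: field_simps)
  finally show ?thesis by (simp add: field_simps)
qed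

lemma derivative_strict_mono:
  assumes "0 \<le> a" "a < b"
  shows "f' a < f' b"
proof -
  have "0 < (f' b - f' a) * (b - a)"
    using strictly_above_tangent[of a b] strictly_above_tangent[of b a] assms
    by (simp add: algebra_simps)
  then show ?thesis using assms by (simp add: zero_less_mult_iff)
qed

abbreviation rate :: "real \<Rightarrow> real" where
  "rate y \<equiv> inverse_rate f' rmax y"

text \<open>These are the three regimes of minimizing \<open>f x - y * x\<close> over the admissible
  rates: minimizer at 0, at the cap, or stationary.\<close>

lemma rate_cases:
  obtains (low) "y < f' 0" "rate y = 0"
  | (high) b where "rmax = ereal b" "0 < b" "f' b < y" "rate y = b"
  | (mid) "f' (rate y) = y" "0 \<le> rate y" "ereal (rate y) \<le> rmax"
proof -
  consider "y < f' 0"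
    | b where "rmax = ereal b" "0 < b" "f' b < y" "f' 0 \<le> y"
    | b where "rmax = ereal b" "0 < b" "y \<le> f' b" "f' 0 \<le> y"
    | "rmax = \<infinity>" "f' 0 \<le> y"
    using max_rate by (cases rmax) (auto simp: not_less[symmetric])
  then show thesis
  proof cases
    case 1
    then show ?thesis using low by (simp add: inverse_rate_def)
  next
    case 2
    then show ?thesis using high by (simp add: inverse_rate_def)
  next
    case (3 b)
    have "(f has_real_derivative f' x) (at x within {0..b})" if "0 \<le> x" for x
      using derivative[OF that] by (rule DERIV_subset) auto
    then obtain x where x: "0 \<le> x" "x \<le> b" "f' x = y"
      using derivative_intermediate_value[of 0 b f' y f] 3 by (metis less_imp_le)
    define r where "r = inv_into {0..} f' y"
    have r: "rate y = r" using 3 by (simp add: inverse_rate_def r_def)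
    have "f' r = y" "0 \<le> r"
      using f_inv_into_f[of y f' "{0..}"] inv_into_into[of y f' "{0..}"] x by (auto simp: r_def)
    \<comment> \<open>\<open>inv_into\<close> picks a preimage from all of \<open>{0..}\<close>;
      strict monotonicity of \<open>f'\<close> keeps it from exceeding \<open>x\<close>, hence
      \<open>b\<close>.\<close>
    moreover have "r \<le> b"
      using derivative_strict_mono[of x r] x calculation by linarith
    ultimately show ?thesis using mid r 3(1) by simp
  next
    case 4
    then have "y \<in> f' ` {0..}" using unbounded by auto
    then show ?thesis
      using mid 4 f_inv_into_f[of y f' "{0..}"] inv_into_into[of y f' "{0..}"]
      by (simp add: inverse_rate_def)
  qed
qed

lemma rate_nonneg: "0 \<le> rate y"
  by (cases y rule: rate_cases) auto

lemma rate_le: "ereal (rate y) \<le> rmax"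
  using max_rate by (cases y rule: rate_cases) (auto simp: zero_ereal_def)

text \<open>First-order optimality: in each regime, \<open>f' (rate y) - y\<close> is zero or has
  the sign of every admissible move \<open>x - rate y\<close>. The strict tangent inequality does
  the rest.\<close>

lemma rate_minimizes_strict:
  assumes "0 \<le> x" "ereal x \<le> rmax" "x \<noteq> rate y"
  shows "f (rate y) - y * rate y < f x - y * x"
proof -
  have "f (rate y) + f' (rate y) * (x - rate y) < f x"
    using strictly_above_tangent rate_nonneg assms by blast
  moreover have "y * (x - rate y) \<le> f' (rate y) * (x - rate y)"
  proof (cases y rule: rate_cases)
    case low
    then show ?thesis using assms by (simp add: mult_right_mono)
  next
    case (high b)
    then show ?thesis using assms by (simp add: mult_right_mono_neg)
  qed simp
  ultimately show ?thesis by (simp add: algebra_simps)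
qed

lemma rate_minimizes:
  assumes "0 \<le> x" "ereal x \<le> rmax"
  shows "f (rate y) - y * rate y \<le> f x - y * x"
  using rate_minimizes_strict[OF assms] by fastforce

lemma optimal_cost_nonpos: "f (rate y) - y * rate y \<le> 0"
  using rate_minimizes[of 0 y] max_rate by (simp add: zero less_imp_le flip: zero_ereal_def)

text \<open>The zero rate also has cost 0, and the minimizer is unique. This is why rates vanish
  where the schedule switches off.\<close>

lemma rate_eq_0_if_optimal_cost_eq_0:
  assumes "f (rate y) - y * rate y = 0"
  shows "rate y = 0"
  using rate_minimizes_strict[of 0 y] max_rate assms
  by (cases "rate y = 0") (auto simp: zero less_imp_le simp flip: zero_ereal_def)

text \<open>For \<open>y \<le> 0\<close> the cost is nonnegative because \<open>f\<close> is, so the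
  optimal cost is 0. Arguing by cost also covers \<open>y = f' 0 = 0\<close>, where
  \<open>inverse_rate\<close> does not take its first branch.\<close>

lemma rate_nonpos_eq_0:
  assumes "y \<le> 0"
  shows "rate y = 0"
proof -
  have "0 \<le> f (rate y) - y * rate y"
    using nonneg[OF rate_nonneg, of y] mult_nonpos_nonneg[OF assms rate_nonneg, of y]
    by linarith
  then show ?thesis
    using optimal_cost_nonpos[of y] by (intro rate_eq_0_if_optimal_cost_eq_0) simp
qed

text \<open>Together with \<open>rate_less_iff\<close>, this turns strict bounds on the rate into
  strict, hence open, conditions on \<open>y\<close>.\<close>

lemma less_rate_iff:
  assumes "0 \<le> a" "ereal a < rmax"
  shows "a < rate y \<longleftrightarrow> f' a < y"
proof (cases y rule: rate_cases)
  case low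
  then show ?thesis using assms derivative_strict_mono[of 0 a] by (cases "a = 0") auto
next
  case (high b)
  then show ?thesis using assms derivative_strict_mono[of a b] by auto
next
  case mid
  then show ?thesis
    using derivative_strict_mono[of a "rate y"] derivative_strict_mono[of "rate y" a] assms
    by (cases a "rate y" rule: linorder_cases) auto
qed

lemma rate_less_iff:
  assumes "0 < b" "ereal b \<le> rmax"
  shows "rate y < b \<longleftrightarrow> y < f' b"
proof (cases y rule: rate_cases)
  case low
  then show ?thesis using assms derivative_strict_mono[of 0 b] by auto
next
  case (high c)
  then show ?thesis using assms derivative_strict_mono[of b c] by (cases "b = c") auto
next
  case mid
  then show ?thesis
    using derivative_strict_mono[of b "rate y"] derivative_strict_mono[of "rate y" b] assms
    by (cases b "rate y" rule: linorder_cases) auto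
qed

text \<open>The inverse of a strictly increasing function is continuous even if \<open>f'\<close>
  jumps: the two equivalences make the sets of \<open>y\<close> with \<open>a < rate y\<close> or
  \<open>rate y < b\<close> open. Levels outside the range of admissible rates are trivial.\<close>

lemma continuous_rate: "continuous_on UNIV rate"
proof -
  have "(rate \<longlongrightarrow> rate y) (at y)" for y
  proof (rule order_tendstoI)
    fix a assume a: "a < rate y"
    show "\<forall>\<^sub>F z in at y. a < rate z"
    proof (cases "a < 0")
      case True
      then have "a < rate z" for z using rate_nonneg[of z] by linarith
      then show ?thesis by simp
    next
      case False
      have rm: "ereal a < rmax" using a rate_le[of y]
        by (metis ereal_less_eq(3) less_ereal.simps(1) order_less_le_trans)
      have "f' a < y" using less_rate_iff[of a y] False rm a by simp
      then have "\<forall>\<^sub>F z in at y. f' a < z"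
        using order_tendstoD(1)[OF tendsto_ident_at] by blast
      then show ?thesis
        using less_rate_iff[of a] False rm by simp
    qed
  next
    fix b assume b: "rate y < b"
    show "\<forall>\<^sub>F z in at y. rate z < b"
    proof (cases "rmax < ereal b")
      case True
      then have "rate z < b" for z
        using rate_le[of z] by (metis less_ereal.simps(1) order_le_less_trans)
      then show ?thesis by simp
    next
      case False
      then have rm: "ereal b \<le> rmax" by simp
      have b0: "0 < b" using b rate_nonneg[of y] by linarith
      have "y < f' b" using rate_less_iff[of b y] b0 rm b by simp
      then have "\<forall>\<^sub>F z in at y. z < f' b"
        using order_tendstoD(2)[OF tendsto_ident_at] by blast
      then show ?thesis
        using rate_less_iff[of b] b0 rm by simp
    qed
  qed
  then show ?thesis by (simp add: continuous_on_def)
qed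

end

section \<open>Costs and smooth shares on a single channel\<close>

locale scheduling =
  fixes p :: "('q ^ 'k ^ 'm) pmf"
    and \<mu> rmin :: "real ^ 'm"
    and Y dY :: "'q \<Rightarrow> real \<Rightarrow> real"
    and rmax :: ereal
    and \<epsilon> :: real
  assumes finite_states: "finite (set_pmf p)"
    and weights: "\<And>m. 0 < \<mu> $ m"
    and requirements: "\<And>m. 0 \<le> rmin $ m"
    and power_rate: "\<And>J m k. J \<in> set_pmf p \<Longrightarrow> power_rate (Y (J $ m $ k)) (dY (J $ m $ k)) rmax"
    and feasible: "strictly_feasible p rmax rmin"
    and eps: "0 < \<epsilon>"
begin

abbreviation "rate (J :: 'q ^ 'k ^ 'm) lam m k \<equiv> nominal_rate \<mu> dY rmax J lam $ m $ k"
abbreviation "cost (J :: 'q ^ 'k ^ 'm) lam m k \<equiv> cost_W \<mu> Y dY rmax J lam $ m $ k"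
abbreviation "least_cost (J :: 'q ^ 'k ^ 'm) lam k \<equiv> min_cost \<mu> Y dY rmax J lam $ k"
abbreviation "share (J :: 'q ^ 'k ^ 'm) lam m k \<equiv> smooth_schedule \<mu> Y dY rmax \<epsilon> J lam $ m $ k"
abbreviation "L \<equiv> lagrangian p \<mu> Y rmin"
abbreviation "D \<equiv> dual_function p \<mu> Y rmax rmin"
abbreviation "Ds \<equiv> smooth_dual p \<mu> Y dY rmax rmin \<epsilon>"
abbreviation "g \<equiv> smooth_subgradient p \<mu> Y dY rmax rmin \<epsilon>"
abbreviation "smooth_rates lam J \<equiv> (\<chi> m k. rate J lam m k * share J lam m k)"
abbreviation "smooth_shares lam J \<equiv> smooth_schedule \<mu> Y dY rmax \<epsilon> J lam"

lemma rate_eq: "rate J lam m k = inverse_rate (dY (J $ m $ k)) rmax (lam $ m / \<mu> $ m)"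
  by (simp add: nominal_rate_def)

lemma cost_eq: "cost J lam m k = \<mu> $ m * Y (J $ m $ k) (rate J lam m k) - lam $ m * rate J lam m k"
  by (simp add: cost_W_def)

text \<open>Factoring out the weight leaves the one-function problem of \<open>power_rate\<close> at
  slope \<open>lam $ m / \<mu> $ m\<close>.\<close>

lemma cost_eq_scaled:
  "cost J lam m k =
     \<mu> $ m * (Y (J $ m $ k) (rate J lam m k) - lam $ m / \<mu> $ m * rate J lam m k)"
  using weights[of m] by (simp add: cost_eq field_simps)

lemma rate_nonneg: "J \<in> set_pmf p \<Longrightarrow> 0 \<le> rate J lam m k"
  using power_rate.rate_nonneg[OF power_rate] by (simp add: rate_eq)

lemma rate_le: "J \<in> set_pmf p \<Longrightarrow> ereal (rate J lam m k) \<le> rmax"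
  using power_rate.rate_le[OF power_rate] by (simp add: rate_eq)

lemma rate_eq_0: "J \<in> set_pmf p \<Longrightarrow> lam $ m = 0 \<Longrightarrow> rate J lam m k = 0"
  using power_rate.rate_nonpos_eq_0[OF power_rate] by (simp add: rate_eq)

lemma cost_nonpos: "J \<in> set_pmf p \<Longrightarrow> cost J lam m k \<le> 0"
  unfolding cost_eq_scaled rate_eq
  by (rule mult_nonneg_nonpos[OF less_imp_le[OF weights]
        power_rate.optimal_cost_nonpos[OF power_rate]])

lemma rate_eq_0_if_cost_eq_0:
  assumes "J \<in> set_pmf p" "cost J lam m k = 0"
  shows "rate J lam m k = 0"
proof -
  have "Y (J $ m $ k) (rate J lam m k) - lam $ m / \<mu> $ m * rate J lam m k = 0"
    using assms(2) weights[of m] unfolding cost_eq_scaled by (simp only: mult_eq_0_iff) simp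
  then show ?thesis
    unfolding rate_eq by (rule power_rate.rate_eq_0_if_optimal_cost_eq_0[OF power_rate[OF assms(1)]])
qed

lemma cost_le:
  assumes "J \<in> set_pmf p" "0 \<le> x" "ereal x \<le> rmax"
  shows "cost J lam m k \<le> \<mu> $ m * Y (J $ m $ k) x - lam $ m * x"
proof -
  have "cost J lam m k \<le> \<mu> $ m * (Y (J $ m $ k) x - lam $ m / \<mu> $ m * x)"
    unfolding cost_eq_scaled rate_eq
    by (rule mult_left_mono[OF power_rate.rate_minimizes[OF power_rate]])
      (use assms weights[of m] in \<open>auto intro: less_imp_le\<close>)
  also have "\<dots> = \<mu> $ m * Y (J $ m $ k) x - lam $ m * x"
    using weights[of m] by (simp add: field_simps)
  finally show ?thesis .
qed

lemma continuous_rate: "J \<in> set_pmf p \<Longrightarrow> continuous_on UNIV (\<lambda>lam. rate J lam m k)"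
  unfolding rate_eq
  by (rule continuous_on_compose2[OF power_rate.continuous_rate[OF power_rate]])
    (use weights[of m] in \<open>intro continuous_intros | simp\<close>)+

lemma continuous_cost:
  assumes "J \<in> set_pmf p"
  shows "continuous_on UNIV (\<lambda>lam. cost J lam m k)"
proof -
  have "continuous_on {0..} (Y (J $ m $ k))"
    using power_rate.derivative[OF power_rate[OF assms]] by (intro DERIV_continuous_on) auto
  then have "continuous_on UNIV (\<lambda>lam. Y (J $ m $ k) (rate J lam m k))"
    by (rule continuous_on_compose2[OF _ continuous_rate[OF assms]]) (auto simp: rate_nonneg assms)
  then show ?thesis
    unfolding cost_eq by (intro continuous_intros continuous_rate assms)
qed

lemma least_cost_eq: "least_cost J lam k = Min (range (\<lambda>m. cost J lam m k))"
  by (simp add: min_cost_def)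

lemma continuous_least_cost:
  "J \<in> set_pmf p \<Longrightarrow> continuous_on UNIV (\<lambda>lam. least_cost J lam k)"
  unfolding least_cost_eq by (rule continuous_on_Min_image) (auto intro: continuous_cost)

lemma least_cost_le: "least_cost J lam k \<le> cost J lam m k"
  by (simp add: least_cost_eq)

lemma least_cost_attained: obtains m where "cost J lam m k = least_cost J lam k"
proof -
  have "least_cost J lam k \<in> range (\<lambda>m. cost J lam m k)"
    unfolding least_cost_eq by (rule Min_in) auto
  then show thesis using that by auto
qed

lemma least_cost_nonpos: "J \<in> set_pmf p \<Longrightarrow> least_cost J lam k \<le> 0"
  using least_cost_le cost_nonpos order_trans by blast

text \<open>Truncation at 0 replaces the index set \<open>smooth_users\<close>, which varies with
  \<open>lam\<close>, by a formula for all users that is continuous in \<open>lam\<close>.\<close>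

definition weight :: "'q ^ 'k ^ 'm \<Rightarrow> real ^ 'm \<Rightarrow> 'm \<Rightarrow> 'k \<Rightarrow> real" where
  "weight J lam m k = (max 0 (1 - (cost J lam m k - least_cost J lam k) / \<epsilon>))\<^sup>2"

definition total_weight :: "'q ^ 'k ^ 'm \<Rightarrow> real ^ 'm \<Rightarrow> 'k \<Rightarrow> real" where
  "total_weight J lam k = (\<Sum>m\<in>UNIV. weight J lam m k)"

text \<open>A user of least cost has weight exactly 1, so the normalization never divides by
  0.\<close>

lemma total_weight_ge_1: "1 \<le> total_weight J lam k"
proof -
  obtain m where m: "cost J lam m k = least_cost J lam k"
    by (rule least_cost_attained)
  have "weight J lam m k \<le> total_weight J lam k"
    unfolding total_weight_def by (rule member_le_sum) (auto simp: weight_def)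
  then show ?thesis by (simp add: weight_def m)
qed

text \<open>If the least cost is negative, users outside \<open>smooth_users\<close> have truncated
  weight 0, so summing over that set or over all users gives the same denominator.\<close>

lemma share_eq:
  "share J lam m k =
     (if least_cost J lam k < 0 then weight J lam m k / total_weight J lam k else 0)"
proof -
  let ?U = "smooth_users \<mu> Y dY rmax \<epsilon> J lam k"
  have in_U: "m \<in> ?U \<longleftrightarrow> least_cost J lam k < 0 \<and>
      0 < 1 - (cost J lam m k - least_cost J lam k) / \<epsilon>" for m
    using eps by (auto simp: smooth_users_def field_simps)
  have w: "(smooth_weight \<mu> Y dY rmax \<epsilon> J lam m k)\<^sup>2 = weight J lam m k" if "m \<in> ?U" for m
    using that in_U[of m] by (simp add: smooth_weight_def weight_def)
  show ?thesis
  proof (cases "least_cost J lam k < 0")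
    case True
    have w0: "weight J lam m k = 0" if "m \<notin> ?U" for m
      using that in_U[of m] True by (simp add: weight_def)
    have "(\<Sum>m\<in>?U. (smooth_weight \<mu> Y dY rmax \<epsilon> J lam m k)\<^sup>2) = (\<Sum>m\<in>?U. weight J lam m k)"
      using w by (rule sum.cong[OF refl])
    also have "\<dots> = total_weight J lam k"
      unfolding total_weight_def by (rule sum.mono_neutral_left) (auto simp: w0)
    finally show ?thesis
      using True w[of m] w0[of m] by (simp add: smooth_schedule_def)
  next
    case False
    then show ?thesis using in_U by (simp add: smooth_schedule_def)
  qed
qed

lemma share_nonneg: "0 \<le> share J lam m k"
  using total_weight_ge_1[of J lam k] by (simp add: share_eq weight_def)

lemma sum_share: "(\<Sum>m\<in>UNIV. share J lam m k) = (if least_cost J lam k < 0 then 1 else 0)"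
  using total_weight_ge_1[of J lam k]
  by (auto simp: share_eq total_weight_def simp flip: sum_divide_distrib)

lemma cost_less_if_share_nonzero:
  assumes "share J lam m k \<noteq> 0"
  shows "cost J lam m k < least_cost J lam k + \<epsilon>"
proof (rule ccontr)
  assume "\<not> ?thesis"
  then have "1 - (cost J lam m k - least_cost J lam k) / \<epsilon> \<le> 0"
    using eps by (simp add: field_simps)
  then have "weight J lam m k = 0" by (simp add: weight_def)
  with assms show False by (simp add: share_eq split: if_splits)
qed

section \<open>Continuity of the smooth subgradient\<close>

text \<open>
  The schedule itself jumps where the least cost reaches \<open>0\<close>, but there all rates vanish.
\<close>

lemma rate_times_share:
  assumes "J \<in> set_pmf p"
  shows "rate J lam m k * share J lam m k =
    rate J lam m k * (weight J lam m k / total_weight J lam k)"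
proof (cases "least_cost J lam k < 0")
  case False
  then have "cost J lam m k = 0"
    using cost_nonpos[OF assms, of lam m k] least_cost_le[of J lam k m] by linarith
  then show ?thesis using rate_eq_0_if_cost_eq_0[OF assms] by simp
qed (simp add: share_eq)

lemma continuous_rate_times_share:
  assumes "J \<in> set_pmf p"
  shows "continuous_on UNIV (\<lambda>lam. rate J lam m k * share J lam m k)"
proof -
  have w: "continuous_on UNIV (\<lambda>lam. weight J lam m k)" for m
    unfolding weight_def using eps
    by (intro continuous_intros continuous_cost continuous_least_cost assms) auto
  then have "continuous_on UNIV (\<lambda>lam. total_weight J lam k)"
    unfolding total_weight_def by (intro continuous_on_sum) auto
  moreover have "total_weight J lam k \<noteq> 0" for lam
    using total_weight_ge_1[of J lam k] by linarith
  ultimately show ?thesis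
    unfolding rate_times_share[OF assms]
    by (intro continuous_on_mult continuous_on_divide continuous_rate w assms ballI)
qed

lemma continuous_smooth_subgradient: "continuous_on UNIV g"
  unfolding smooth_subgradient_def
  by (intro continuous_intros continuous_rate_times_share) auto

lemma max_rate_pos: "0 < rmax"
  using power_rate.max_rate[OF power_rate] set_pmf_not_empty[of p] by blast

text \<open>The quotient of rate and share is the nominal rate where the share is nonzero and 0
  elsewhere; both respect \<open>rmax\<close>.\<close>

lemma smooth_allocation: "(smooth_rates lam, smooth_shares lam) \<in> allocations p rmax"
  using max_rate_pos rate_le
  by (auto simp: allocations_def rate_nonneg share_nonneg sum_share less_imp_le
      simp flip: zero_ereal_def)

section \<open>Bounds on the Lagrangian, the dual function and the smooth dual\<close>

text \<open>Dual decomposition: for fixed multipliers the Lagrangian splits into separate problems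
  for each state and channel.\<close>

lemma lagrangian_eq:
  "L lam R W = (\<Sum>J\<in>set_pmf p. \<Sum>k\<in>UNIV. (\<Sum>m\<in>UNIV.
      \<mu> $ m * Y (J $ m $ k) (R J $ m $ k / W J $ m $ k) * W J $ m $ k - lam $ m * R J $ m $ k) * pmf p J)
    + (\<Sum>m\<in>UNIV. lam $ m * rmin $ m)"
proof -
  have "(\<Sum>m\<in>UNIV. lam $ m * (\<Sum>J\<in>set_pmf p. \<Sum>k\<in>UNIV. R J $ m $ k * pmf p J)) =
      (\<Sum>m\<in>UNIV. \<Sum>J\<in>set_pmf p. \<Sum>k\<in>UNIV. lam $ m * R J $ m $ k * pmf p J)"
    by (simp add: sum_distrib_left mult.assoc)
  also have "\<dots> = (\<Sum>J\<in>set_pmf p. \<Sum>m\<in>UNIV. \<Sum>k\<in>UNIV. lam $ m * R J $ m $ k * pmf p J)"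
    by (rule sum.swap)
  finally have "L lam R W = (\<Sum>J\<in>set_pmf p. \<Sum>m\<in>UNIV. \<Sum>k\<in>UNIV.
      (\<mu> $ m * Y (J $ m $ k) (R J $ m $ k / W J $ m $ k) * W J $ m $ k - lam $ m * R J $ m $ k) * pmf p J)
    + (\<Sum>m\<in>UNIV. lam $ m * rmin $ m)"
    by (simp add: lagrangian_def left_diff_distrib sum_subtractf)
  moreover have "(\<Sum>m\<in>UNIV. \<Sum>k\<in>UNIV.
      (\<mu> $ m * Y (J $ m $ k) (R J $ m $ k / W J $ m $ k) * W J $ m $ k - lam $ m * R J $ m $ k) * pmf p J)
    = (\<Sum>k\<in>UNIV. (\<Sum>m\<in>UNIV.
      \<mu> $ m * Y (J $ m $ k) (R J $ m $ k / W J $ m $ k) * W J $ m $ k - lam $ m * R J $ m $ k) * pmf p J)" for J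
    unfolding sum_distrib_right by (rule sum.swap)
  ultimately show ?thesis by (simp only:)
qed

text \<open>\<open>L 0\<close> is the average power; the multipliers only price the violation of the
  rate constraints.\<close>

lemma lagrangian_zero_multiplier:
  "L lam R W = L 0 R W +
    (\<Sum>m\<in>UNIV. lam $ m * (rmin $ m - (\<Sum>J\<in>set_pmf p. \<Sum>k\<in>UNIV. R J $ m $ k * pmf p J)))"
  by (simp add: lagrangian_def right_diff_distrib sum_subtractf)

text \<open>The constraint violations of the smooth allocation are the entries of
  \<open>g lam\<close>, so at a zero of \<open>g\<close> the smooth dual is the power alone.\<close>

lemma smooth_dual_eq: "Ds lam = L 0 (smooth_rates lam) (smooth_shares lam) + lam \<bullet> g lam"
  unfolding smooth_dual_def
  by (subst lagrangian_zero_multiplier) (simp add: inner_vec_def smooth_subgradient_def)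

lemma lagrangian_zero_nonneg:
  assumes "(R, W) \<in> allocations p rmax"
  shows "0 \<le> L 0 R W"
proof -
  have "0 \<le> \<mu> $ m * Y (J $ m $ k) (R J $ m $ k / W J $ m $ k) * W J $ m $ k * pmf p J"
    if "J \<in> set_pmf p" for J m k
    using that assms weights[of m] power_rate.nonneg[OF power_rate[OF that]]
    by (auto simp: allocations_def less_imp_le intro!: mult_nonneg_nonneg)
  then show ?thesis
    by (auto simp: lagrangian_def intro!: sum_nonneg)
qed

text \<open>Each channel contributes at best its least cost. This explicit value is the pivot
  between \<open>D\<close> and \<open>Ds\<close>.\<close>

definition lower_dual :: "real ^ 'm \<Rightarrow> real" where
  "lower_dual lam = (\<Sum>J\<in>set_pmf p. \<Sum>k\<in>UNIV. least_cost J lam k * pmf p J)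
     + (\<Sum>m\<in>UNIV. lam $ m * rmin $ m)"

lemma lower_dual_le_lagrangian:
  assumes "(R, W) \<in> allocations p rmax"
  shows "lower_dual lam \<le> L lam R W"
proof -
  have "least_cost J lam k \<le> (\<Sum>m\<in>UNIV.
      \<mu> $ m * Y (J $ m $ k) (R J $ m $ k / W J $ m $ k) * W J $ m $ k - lam $ m * R J $ m $ k)"
    (is "_ \<le> (\<Sum>m\<in>UNIV. ?c m)") if J: "J \<in> set_pmf p" for J k
  proof -
    have a: "0 \<le> R J $ m $ k" "0 \<le> W J $ m $ k" "W J $ m $ k = 0 \<Longrightarrow> R J $ m $ k = 0"
      "ereal (R J $ m $ k / W J $ m $ k) \<le> rmax" for m
      using assms J by (auto simp: allocations_def)
    \<comment> \<open>The shares sum to at most 1 and the least cost is nonpositive, so scaling by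
      the sum can only raise it.\<close>
    have "least_cost J lam k \<le> (\<Sum>m\<in>UNIV. W J $ m $ k) * least_cost J lam k"
      using assms J least_cost_nonpos[OF J, of lam k]
        mult_right_mono_neg[of "\<Sum>m\<in>UNIV. W J $ m $ k" 1 "least_cost J lam k"]
      by (auto simp: allocations_def)
    also have "\<dots> \<le> (\<Sum>m\<in>UNIV. ?c m)"
      unfolding sum_distrib_right
    proof (rule sum_mono)
      fix m
      have "W J $ m $ k * least_cost J lam k \<le> W J $ m $ k * cost J lam m k"
        by (rule mult_left_mono[OF least_cost_le a(2)])
      also have "\<dots> \<le> W J $ m $ k * (\<mu> $ m * Y (J $ m $ k) (R J $ m $ k / W J $ m $ k)
          - lam $ m * (R J $ m $ k / W J $ m $ k))"
        using a by (intro mult_left_mono cost_le J) auto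
      also have "\<dots> = ?c m"
        using a(3)[of m] by (cases "W J $ m $ k = 0") (auto simp: field_simps)
      finally show "W J $ m $ k * least_cost J lam k \<le> ?c m" .
    qed
    finally show ?thesis .
  qed
  then show ?thesis
    unfolding lower_dual_def lagrangian_eq
    by (intro add_right_mono sum_mono mult_right_mono) auto
qed

lemma dual_le_lagrangian:
  assumes "(R, W) \<in> allocations p rmax"
  shows "D lam \<le> L lam R W"
proof -
  \<comment> \<open>A real infimum bounds its members from below only if the family is bounded
    below; \<open>lower_dual\<close> supplies the bound.\<close>
  have "bdd_below ((\<lambda>(R, W). L lam R W) ` allocations p rmax)"
    by (rule bdd_belowI2[of _ "lower_dual lam"]) (auto intro: lower_dual_le_lagrangian)
  then show ?thesis
    unfolding dual_function_def using cINF_lower[of "\<lambda>(R, W). L lam R W" _ "(R, W)"] assms by auto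
qed

lemma lower_dual_le_dual: "lower_dual lam \<le> D lam"
  unfolding dual_function_def
  by (rule cINF_greatest) (use smooth_allocation in \<open>auto intro: lower_dual_le_lagrangian\<close>)

text \<open>A served channel costs a convex combination of user costs, each strictly within
  \<open>\<epsilon>\<close> of the least. Averaging over states and summing over channels gives the
  gap.\<close>

lemma smooth_dual_less: "Ds lam < lower_dual lam + real CARD('k) * \<epsilon>"
proof -
  have "(\<Sum>m\<in>UNIV. \<mu> $ m * Y (J $ m $ k) (smooth_rates lam J $ m $ k / share J lam m k) * share J lam m k
      - lam $ m * smooth_rates lam J $ m $ k) < least_cost J lam k + \<epsilon>"
    (is "(\<Sum>m\<in>UNIV. ?c m) < _") if J: "J \<in> set_pmf p" for J k
  proof -
    have "?c m = share J lam m k * cost J lam m k" for m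
      by (cases "share J lam m k = 0") (auto simp: cost_eq field_simps)
    then have c: "(\<Sum>m\<in>UNIV. ?c m) = (\<Sum>m\<in>UNIV. share J lam m k * cost J lam m k)"
      by simp
    show ?thesis
    proof (cases "least_cost J lam k < 0")
      case True
      have le: "share J lam m k * cost J lam m k \<le> share J lam m k * (least_cost J lam k + \<epsilon>)" for m
        using cost_less_if_share_nonzero[of J lam m k] share_nonneg[of J lam m k]
        by (cases "share J lam m k = 0") (auto intro!: mult_left_mono)
      \<comment> \<open>The shares sum to 1, so some user is served; that user makes the sum
        strictly smaller.\<close>
      obtain m where m: "share J lam m k \<noteq> 0"
        using sum_share[of J lam k] True by (metis (no_types, lifting) sum.neutral zero_neq_one)
      have "share J lam m k * cost J lam m k < share J lam m k * (least_cost J lam k + \<epsilon>)"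
        using m share_nonneg[of J lam m k] cost_less_if_share_nonzero[OF m]
        by (intro mult_strict_left_mono) auto
      then have "(\<Sum>m\<in>UNIV. share J lam m k * cost J lam m k) <
          (\<Sum>m\<in>UNIV. share J lam m k * (least_cost J lam k + \<epsilon>))"
        using le by (intro sum_strict_mono_ex1) auto
      also have "\<dots> = least_cost J lam k + \<epsilon>"
        using sum_share[of J lam k] True by (simp flip: sum_distrib_right)
      finally show ?thesis using c by simp
    \<comment> \<open>Here the least cost is not negative: the channel stays idle and contributes 0,
      which is below the least cost plus \<open>\<epsilon>\<close>.\<close>
    next
      case False
      then have "share J lam m k = 0" for m by (simp add: share_eq)
      then show ?thesis using c False eps by simp
    qed
  qed
  then have "Ds lam < (\<Sum>J\<in>set_pmf p. \<Sum>k\<in>UNIV. (least_cost J lam k + \<epsilon>) * pmf p J)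
      + (\<Sum>m\<in>UNIV. lam $ m * rmin $ m)"
    unfolding smooth_dual_def lagrangian_eq
    by (intro add_strict_right_mono sum_strict_mono mult_strict_right_mono)
      (auto simp: finite_states set_pmf_not_empty pmf_positive)
  also have "\<dots> = lower_dual lam + real CARD('k) * \<epsilon> * (\<Sum>J\<in>set_pmf p. pmf p J)"
    by (simp add: lower_dual_def distrib_right sum.distrib sum_distrib_left mult.assoc)
  also have "(\<Sum>J\<in>set_pmf p. pmf p J) = 1"
    by (rule sum_pmf_eq_1) (auto simp: finite_states)
  finally show ?thesis by simp
qed

section \<open>Existence of a zero of the smooth subgradient\<close>

text \<open>
  Slater's condition: with slack at least \<open>d\<close> in every rate constraint at a point of power \<open>P\<close>,
  the dual function is at most \<open>P - d \<Sum> lam\<close>, which is negative far out in the orthant.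
\<close>

lemma inner_smooth_subgradient_neg:
  obtains B where "0 < B"
    "\<And>lam. (\<And>m. 0 \<le> lam $ m) \<Longrightarrow> B \<le> (\<Sum>m\<in>UNIV. lam $ m) \<Longrightarrow> lam \<bullet> g lam < 0"
proof -
  obtain R W where RW: "(R, W) \<in> allocations p rmax"
    and slack: "\<And>m. rmin $ m < (\<Sum>J\<in>set_pmf p. \<Sum>k\<in>UNIV. R J $ m $ k * pmf p J)"
    using feasible by (auto simp: strictly_feasible_def)
  define s where "s m = (\<Sum>J\<in>set_pmf p. \<Sum>k\<in>UNIV. R J $ m $ k * pmf p J) - rmin $ m" for m
  define d where "d = Min (range s)"
  have "d \<in> range s" unfolding d_def by (rule Min_in) auto
  then have d: "0 < d" using slack by (auto simp: s_def)
  \<comment> \<open>The second summand absorbs the gap between \<open>Ds\<close> and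
    \<open>lower_dual\<close>; \<open>a / d\<close> is where \<open>a\<close> minus \<open>d\<close>
    times the sum of the multipliers reaches 0.\<close>
  define a where "a = L 0 R W + real CARD('k) * \<epsilon>"
  have a: "0 < a"
    using lagrangian_zero_nonneg[OF RW] eps by (auto simp: a_def intro: add_nonneg_pos)
  show thesis
  proof (rule that[of "a / d"])
    show "0 < a / d" using a d by simp
  next
    fix lam :: "real ^ 'm"
    assume lam: "\<And>m. 0 \<le> lam $ m" and B: "a / d \<le> (\<Sum>m\<in>UNIV. lam $ m)"
    \<comment> \<open>The difference is the power of the smooth allocation, which is
      nonnegative.\<close>
    have "lam \<bullet> g lam \<le> Ds lam"
      using smooth_dual_eq[of lam] lagrangian_zero_nonneg[OF smooth_allocation[of lam]] by linarith
    also have "\<dots> < L lam R W + real CARD('k) * \<epsilon>"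
      using smooth_dual_less[of lam] lower_dual_le_lagrangian[OF RW, of lam] by linarith
    also have "\<dots> = a + (\<Sum>m\<in>UNIV. lam $ m * - s m)"
      by (subst lagrangian_zero_multiplier) (simp add: a_def s_def)
    also have "\<dots> \<le> a + (\<Sum>m\<in>UNIV. lam $ m * - d)"
      by (intro add_left_mono sum_mono mult_left_mono lam) (auto simp: d_def)
    also have "\<dots> = a - (\<Sum>m\<in>UNIV. lam $ m) * d"
      by (simp add: sum_negf sum_distrib_right)
    also have "\<dots> \<le> 0"
      using B d by (simp add: field_simps)
    finally show "lam \<bullet> g lam < 0" .
  qed
qed

text \<open>The variational inequality is solved on the orthant cut off at level \<open>B\<close>.
  The solution avoids the outer face, so each coordinate can be raised, and lowered if positive;
  both tests together force \<open>g lam = 0\<close>.\<close>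

lemma smooth_subgradient_zero:
  obtains lam where "\<And>m. 0 \<le> lam $ m" "g lam = 0"
proof -
  obtain B where B: "0 < B"
    "\<And>lam. (\<And>m. 0 \<le> lam $ m) \<Longrightarrow> B \<le> (\<Sum>m\<in>UNIV. lam $ m) \<Longrightarrow> lam \<bullet> g lam < 0"
    using inner_smooth_subgradient_neg by blast
  define C :: "(real ^ 'm) set" where "C = {lam. (\<forall>m. 0 \<le> lam $ m) \<and> (\<Sum>m\<in>UNIV. lam $ m) \<le> B}"
  have C_eq: "C = (\<Inter>m. {lam. 0 \<le> lam $ m}) \<inter> {lam. (\<Sum>m\<in>UNIV. lam $ m) \<le> B}"
    by (auto simp: C_def)
  have "closed C"
    unfolding C_eq
    by (intro closed_Int closed_INT ballI closed_Collect_le continuous_intros)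
  moreover have "C \<subseteq> cbox 0 (\<chi> m. B)"
  proof
    fix lam assume lam: "lam \<in> C"
    have "lam $ m \<le> B" for m
      using lam member_le_sum[of m UNIV "\<lambda>m. lam $ m"] by (force simp: C_def)
    with lam show "lam \<in> cbox 0 (\<chi> m. B)" by (simp add: C_def mem_box_cart)
  qed
  ultimately have "compact C"
    by (metis bounded_cbox bounded_subset compact_eq_bounded_closed)
  moreover have "convex C"
    unfolding convex_def
  proof (intro ballI allI impI)
    fix x y u v assume xy: "x \<in> C" "y \<in> C" and uv: "0 \<le> (u::real)" "0 \<le> v" "u + v = 1"
    have "(\<Sum>m\<in>UNIV. (u *\<^sub>R x + v *\<^sub>R y) $ m) =
        u * (\<Sum>m\<in>UNIV. x $ m) + v * (\<Sum>m\<in>UNIV. y $ m)"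
      by (simp add: sum.distrib sum_distrib_left)
    also have "\<dots> \<le> B"
      using xy uv by (intro convex_bound_le) (auto simp: C_def)
    finally show "u *\<^sub>R x + v *\<^sub>R y \<in> C"
      using xy uv by (simp add: C_def)
  qed
  moreover have C0: "0 \<in> C" using B(1) by (simp add: C_def)
  ultimately obtain lam where lam: "lam \<in> C" "\<And>y. y \<in> C \<Longrightarrow> g lam \<bullet> (y - lam) \<le> 0"
    using variational_inequality[of C g] continuous_on_subset[OF continuous_smooth_subgradient]
    by (metis empty_iff top_greatest)
  have nonneg: "0 \<le> lam $ m" for m using lam(1) by (simp add: C_def)
  \<comment> \<open>Testing against the origin contradicts the negative inner product on the outer
    face.\<close>
  have "0 \<le> lam \<bullet> g lam" using lam(2)[OF C0] by (simp add: inner_commute)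
  then have interior: "(\<Sum>m\<in>UNIV. lam $ m) < B" using B(2)[of lam] nonneg by force
  have "g lam $ m = 0" for m
  proof (rule antisym)
    \<comment> \<open>Coordinate \<open>m\<close> is raised until the outer face is reached.\<close>
    let ?y = "lam + axis m (B - (\<Sum>m\<in>UNIV. lam $ m))"
    have "?y \<in> C"
      using nonneg interior by (simp add: C_def axis_def sum.distrib add_nonneg_nonneg)
    then have "g lam $ m * (B - (\<Sum>m\<in>UNIV. lam $ m)) \<le> 0"
      using lam(2)[of ?y] by (simp add: inner_axis)
    then show "g lam $ m \<le> 0" using interior by (simp add: mult_le_0_iff)
  next
    show "0 \<le> g lam $ m"
    proof (cases "lam $ m = 0")
      \<comment> \<open>A user with zero multiplier has zero rate, so this entry of \<open>g\<close>
        is the rate requirement itself.\<close>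
      case True
      then show ?thesis
        using requirements[of m] rate_eq_0 by (simp add: smooth_subgradient_def)
    next
      case False
      \<comment> \<open>Coordinate \<open>m\<close> is lowered to 0, which stays in
        \<open>C\<close>.\<close>
      let ?y = "lam - axis m (lam $ m)"
      have "(\<Sum>m\<in>UNIV. ?y $ m) \<le> (\<Sum>m\<in>UNIV. lam $ m)"
        using nonneg by (intro sum_mono) (auto simp: axis_def)
      then have "?y \<in> C"
        using nonneg interior by (auto simp: C_def axis_def)
      then have "0 \<le> g lam $ m * lam $ m"
        using lam(2)[of ?y] by (simp add: inner_axis)
      then show ?thesis using False nonneg[of m] by (simp add: zero_le_mult_iff)
    qed
  qed
  then show thesis using that[of lam] nonneg by (simp add: vec_eq_iff)
qed

end

section \<open>The stationary iteration and the bounds at its limit\<close>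

theorem proposition4:
  fixes p :: "('q ^ 'k ^ 'm) pmf"
    and \<mu> rmin lamopt :: "real ^ 'm"
    and Y dY :: "'q \<Rightarrow> real \<Rightarrow> real"
    and rmax :: ereal
    and \<epsilon> \<epsilon>' :: real
  assumes finite_states: "finite (set_pmf p)"
    and weights: "\<And>m. 0 < \<mu> $ m"
    and requirements: "\<And>m. 0 \<le> rmin $ m"
    and increasing: "\<And>J m k. J \<in> set_pmf p \<Longrightarrow> mono_on {0..} (Y (J $ m $ k))"
    and str_convex: "\<And>J m k. J \<in> set_pmf p \<Longrightarrow> strictly_convex_on {0..} (Y (J $ m $ k))"
    and derivative: "\<And>J m k x. J \<in> set_pmf p \<Longrightarrow> 0 \<le> x \<Longrightarrow>
          (Y (J $ m $ k) has_real_derivative dY (J $ m $ k) x) (at x within {0..})"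
    and zero_rate: "\<And>J m k. J \<in> set_pmf p \<Longrightarrow> Y (J $ m $ k) 0 = 0"
    and max_rate: "0 < rmax"
    and unbounded: "\<And>J m k. J \<in> set_pmf p \<Longrightarrow> rmax = \<infinity> \<Longrightarrow>
          {dY (J $ m $ k) 0..} \<subseteq> dY (J $ m $ k) ` {0..}"
    and feasible: "strictly_feasible p rmax rmin"
    and eps: "0 < \<epsilon>"
    and eps': "\<epsilon>' = real CARD('k) * \<epsilon>"
    and dual_opt: "is_arg_max (dual_function p \<mu> Y rmax rmin) (\<lambda>lam. \<forall>m. 0 \<le> lam $ m) lamopt"
  shows "\<exists>\<beta>\<^sub>0>0. \<forall>\<beta>. 0 < \<beta> \<and> \<beta> < \<beta>\<^sub>0 \<longrightarrow>
    (\<exists>lam0 lams.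
       smooth_iterate p \<mu> Y dY rmax rmin \<epsilon> \<beta> lam0 \<longlonglongrightarrow> lams \<and>
       dual_function p \<mu> Y rmax rmin lamopt \<le> smooth_dual p \<mu> Y dY rmax rmin \<epsilon> lams \<and>
       smooth_dual p \<mu> Y dY rmax rmin \<epsilon> lams < dual_function p \<mu> Y rmax rmin lamopt + \<epsilon>')"
proof -
  interpret scheduling p \<mu> rmin Y dY rmax \<epsilon>
  proof (rule scheduling.intro)
    show "power_rate (Y (J $ m $ k)) (dY (J $ m $ k)) rmax" if "J \<in> set_pmf p" for J m k
      using that by (intro power_rate.intro increasing str_convex derivative zero_rate max_rate unbounded)
  qed (use finite_states weights requirements feasible eps in auto)
  obtain lams where lams: "\<And>m. 0 \<le> lams $ m" and zero: "g lams = 0"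
    using smooth_subgradient_zero by blast
  \<comment> \<open>Weak duality: since \<open>g lams = 0\<close>, the allocation at
    \<open>lams\<close> meets all rate constraints with equality, so its Lagrangian is the same for
    every multiplier.\<close>
  have "D lamopt \<le> L lamopt (smooth_rates lams) (smooth_shares lams)"
    by (rule dual_le_lagrangian[OF smooth_allocation])
  also have "\<dots> = L 0 (smooth_rates lams) (smooth_shares lams) + lamopt \<bullet> g lams"
    by (subst lagrangian_zero_multiplier) (simp add: inner_vec_def smooth_subgradient_def)
  also have "\<dots> = Ds lams"
    by (simp add: smooth_dual_eq zero)
  finally have lower: "D lamopt \<le> Ds lams" .
  have "Ds lams < D lams + \<epsilon>'"
    using smooth_dual_less[of lams] lower_dual_le_dual[of lams] eps' by linarith
  \<comment> \<open>As a nonnegative vector, \<open>lams\<close> competes in the maximization that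
    defines \<open>lamopt\<close>.\<close>
  also have "D lams \<le> D lamopt"
    using dual_opt lams by (auto simp: is_arg_max_def not_less)
  finally have upper: "Ds lams < D lamopt + \<epsilon>'" by simp
  have "smooth_iterate p \<mu> Y dY rmax rmin \<epsilon> \<beta> lams i = lams" for \<beta> i
    by (induction i) (simp_all add: zero)
  then have "smooth_iterate p \<mu> Y dY rmax rmin \<epsilon> \<beta> lams \<longlonglongrightarrow> lams" for \<beta>
    by (intro tendsto_eventually always_eventually allI)
  \<comment> \<open>Started at a zero of \<open>g\<close>, the iteration is constant for every
    stepsize, so the threshold 1 is an arbitrary positive choice.\<close>
  with lower upper show ?thesis by (intro exI[of _ 1]) auto
qed

end
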